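(* The function $\psi:\mathcal{P}_M\times\Theta^M\to[0,\infty]$ defined by $$\psi(\boldsymbol{w},\boldsymbol{\theta}) := \inf_{\boldsymbol{\lambda}\in\mathrm{Alt}(\boldsymbol{\theta})}\ \sum_{m=1}^M w_m\, D^{(m)}_{\mathrm{KL}}(\boldsymbol{\theta}_m,\boldsymbol{\lambda}_m)$$ is continuous on $\mathcal{P}_M\times\Theta^M$.
   Context: $M$ arms, $K$ clusters with $1<K<M$, $\Theta\subset\mathbb{R}^d$ compact. For each arm $m$, a parametric family $\{P_m(\cdot\mid\boldsymbol{\rho}):\boldsymbol{\rho}\in\Theta\}$ with $D^{(m)}_{\mathrm{KL}}(\boldsymbol{\rho}_1,\boldsymbol{\rho}_2)=\mathbb{E}_{X\sim P_m(\cdot\mid\boldsymbol{\rho}_1)}\big[\log\frac{P_m(X\mid\boldsymbol{\rho}_1)}{P_m(X\mid\boldsymbol{\rho}_2)}\big]$, assumed finite and uniformly continuous in $(\boldsymbol{\rho}_1,\boldsymbol{\rho}_2)\in\Theta\times\Theta$ for each $m$. $\mathcal{P}_M=\{\boldsymbol{w}\in\mathbb{R}_+^M:\sum_m w_m=1\}$. For $\boldsymbol{\theta}\in\Theta^M$, $\mathcal{C}(\boldsymbol{\theta})\in[K]^M$ is the cluster index vector obtained by single-linkage clustering of the points $\boldsymbol{\theta}_1,\dots,\boldsymbol{\theta}_M$ (start from singletons, repeatedly merge the two clusters at smallest minimum pairwise Euclidean distance, ties broken by a fixed rule, until $K$ clusters remain). $\boldsymbol{c}\sim\boldsymbol{c}'$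 iff $\boldsymbol{c}=\sigma(\boldsymbol{c}')$ for a permutation $\sigma$ of $[K]$. $\mathrm{Alt}(\boldsymbol{\theta})=\{\boldsymbol{\lambda}\in\Theta^M:\mathcal{C}(\boldsymbol{\lambda})\nsim\mathcal{C}(\boldsymbol{\theta})\}$. *)

theory Defs
  imports "HOL-Probability.Probability" "HOL-Combinatorics.Permutations"
begin

(* KL divergence D^(m)(rho1, rho2) = E_{X ~ P_m(.|rho1)} [ log (dP_m(.|rho1) / dP_m(.|rho2)) ],
   natural logarithm.  In the library, KL_divergence b M N integrates log_b (dN/dM) w.r.t. N. *)
definition KLdiv :: "('m \<Rightarrow> 'a \<Rightarrow> 'x measure) \<Rightarrow> 'm \<Rightarrow> 'a \<Rightarrow> 'a \<Rightarrow> real" where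
  "KLdiv P m r1 r2 = KL_divergence (exp 1) (P m r2) (P m r1)"

definition prob_simplex :: "('m::finite \<Rightarrow> real) set" where
  "prob_simplex = {w. (\<forall>m. 0 \<le> w m) \<and> (\<Sum>m\<in>UNIV. w m) = 1}"

definition linkage :: "('m \<Rightarrow> 'a::euclidean_space) \<Rightarrow> 'm set \<Rightarrow> 'm set \<Rightarrow> real" where
  "linkage \<theta> A B = Min {dist (\<theta> i) (\<theta> j) | i j. i \<in> A \<and> j \<in> B}"

definition merge_step ::
  "(('m set \<times> 'm set) set \<Rightarrow> 'm set \<times> 'm set) \<Rightarrow> ('m \<Rightarrow> 'a::euclidean_space) \<Rightarrow> 'm set set \<Rightarrow> 'm set set" where
  "merge_step tb \<theta> Cs =
     (let cands = {(A, B). A \<in> Cs \<and> B \<in> Cs \<and> A \<noteq> B};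
          d = Min ((\<lambda>(A, B). linkage \<theta> A B) ` cands);
          ties = {(A, B) \<in> cands. linkage \<theta> A B = d};
          (A, B) = tb ties
      in insert (A \<union> B) (Cs - {A, B}))"

definition single_linkage ::
  "(('m set \<times> 'm set) set \<Rightarrow> 'm set \<times> 'm set) \<Rightarrow> nat \<Rightarrow> ('m::finite \<Rightarrow> 'a::euclidean_space) \<Rightarrow> 'm set set" where
  "single_linkage tb K \<theta> = (merge_step tb \<theta> ^^ (CARD('m) - K)) {{i} | i. True}"

definition cluster_index ::
  "(('m set \<times> 'm set) set \<Rightarrow> 'm set \<times> 'm set) \<Rightarrow> nat \<Rightarrow> ('m::finite \<Rightarrow> 'a::euclidean_space) \<Rightarrow> ('m \<Rightarrow> nat)" where
  "cluster_index tb K \<theta> = (SOME c. (\<forall>i. c i \<in> {1..K}) \<and>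
      (\<forall>i j. c i = c j \<longleftrightarrow> (\<exists>A\<in>single_linkage tb K \<theta>. i \<in> A \<and> j \<in> A)))"

definition label_equiv :: "nat \<Rightarrow> ('m \<Rightarrow> nat) \<Rightarrow> ('m \<Rightarrow> nat) \<Rightarrow> bool" where
  "label_equiv K c c' \<longleftrightarrow> (\<exists>\<sigma>. \<sigma> permutes {1..K} \<and> c = \<sigma> \<circ> c')"

definition Alt ::
  "(('m set \<times> 'm set) set \<Rightarrow> 'm set \<times> 'm set) \<Rightarrow> nat \<Rightarrow> 'a::euclidean_space set \<Rightarrow> ('m::finite \<Rightarrow> 'a) \<Rightarrow> ('m \<Rightarrow> 'a) set" where
  "Alt tb K \<Theta> \<theta> = {lam. (\<forall>m. lam m \<in> \<Theta>) \<and>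
      \<not> label_equiv K (cluster_index tb K lam) (cluster_index tb K \<theta>)}"

definition psi ::
  "('m \<Rightarrow> 'a \<Rightarrow> 'x measure) \<Rightarrow> (('m set \<times> 'm set) set \<Rightarrow> 'm set \<times> 'm set) \<Rightarrow> nat \<Rightarrow> 'a::euclidean_space set
     \<Rightarrow> ('m::finite \<Rightarrow> real) \<Rightarrow> ('m \<Rightarrow> 'a) \<Rightarrow> ereal" where
  "psi P tb K \<Theta> w \<theta> = (INF lam\<in>Alt tb K \<Theta> \<theta>. ereal (\<Sum>m\<in>UNIV. w m * KLdiv P m (\<theta> m) (lam m)))"

end

theory Submission
  imports Defs
begin

text \<open>
  Write \<open>f((w,\<theta>),\<lambda>) = \<Sum>\<^sub>m w\<^sub>m D\<^sub>m(\<theta>\<^sub>m,\<lambda>\<^sub>m)\<close>, so that \<open>\<psi>(w,\<theta>)\<close> is the infimum of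
  \<open>f((w,\<theta>),\<cdot>)\<close> over the \<open>\<lambda>\<close> whose clustering is inequivalent to that of \<open>\<theta>\<close>.
  Uniform continuity of the divergences on the compact set \<open>\<Theta>\<times>\<Theta>\<close> makes \<open>f\<close>
  continuous in \<open>(w,\<theta>)\<close> uniformly in \<open>\<lambda>\<close>. Near \<open>(w\<^sub>0,\<theta>\<^sub>0)\<close> there are two cases.
  If the clusterings of \<open>\<theta>\<close> and \<open>\<theta>\<^sub>0\<close> are equivalent, both infima range over the same
  set and are close. Otherwise \<open>\<theta>\<close> and \<open>\<theta>\<^sub>0\<close> are alternatives to each other, so
  \<open>0 \<le> \<psi>(w,\<theta>) \<le> f((w,\<theta>),\<theta>\<^sub>0)\<close> and \<open>0 \<le> \<psi>(w\<^sub>0,\<theta>\<^sub>0) \<le> f((w\<^sub>0,\<theta>\<^sub>0),\<theta>)\<close>, and both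
  bounds tend to \<open>f((w\<^sub>0,\<theta>\<^sub>0),\<theta>\<^sub>0) = 0\<close>.

  Nothing specific to single-linkage clustering is used, only that \<open>Alt(\<theta>)\<close> depends
  on \<open>\<theta>\<close> through the \<open>\<sim>\<close>-class of \<open>C(\<theta>)\<close>.
\<close>

lemma (in information_space) KL_nonneg_ac:
  assumes "prob_space N"
  assumes ac: "absolutely_continuous M N" "sets N = sets M"
  assumes int: "integrable N (entropy_density b M N)"
  shows "0 \<le> KL_divergence b M N"
proof -
  interpret N: prob_space N by fact
  have "finite_measure N" by unfold_locales
  from real_RN_deriv[OF this ac] obtain D
    where D:
      "random_variable borel D"
      "AE x in M. RN_deriv M N x = ennreal (D x)"
      "AE x in N. 0 < D x"
      "\<And>x. 0 \<le> D x"
    by this auto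
  have "N = density M (RN_deriv M N)"
    using ac by (rule density_RN_deriv[symmetric])
  also have "\<dots> = density M D"
    using D by (auto intro!: density_cong)
  finally have N: "N = density M D" .
  from absolutely_continuous_AE[OF ac(2,1) D(2)] D b_gt_1 ac measurable_entropy_density
  have "integrable N (\<lambda>x. log b (D x))"
    by (intro integrable_cong_AE[THEN iffD2, OF _ _ _ int])
       (auto simp: N entropy_density_def)
  with D b_gt_1 have "integrable M (\<lambda>x. D x * log b (D x))"
    by (subst integrable_real_density[symmetric]) (auto simp: N[symmetric] comp_def)
  with \<open>prob_space N\<close> D show ?thesis
    unfolding N by (intro KL_nonneg) auto
qed

lemma KLdiv_nonneg:
  assumes "prob_space (P m r1)" "prob_space (P m r2)" "sets (P m r1) = sets (P m r2)"
    and "absolutely_continuous (P m r2) (P m r1)"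
    and "integrable (P m r1) (entropy_density (exp 1) (P m r2) (P m r1))"
  shows "0 \<le> KLdiv P m r1 r2"
proof -
  interpret prob_space "P m r2" by fact
  interpret information_space "P m r2" "exp 1" by unfold_locales simp
  show ?thesis
    unfolding KLdiv_def by (rule KL_nonneg_ac) (use assms in auto)
qed

lemma KLdiv_self:
  assumes "prob_space (P m r)"
  shows "KLdiv P m r r = 0"
proof -
  interpret prob_space "P m r" by fact
  show ?thesis unfolding KLdiv_def by (rule KL_same_eq_0)
qed

lemma label_equiv_sym: "label_equiv K c c' \<Longrightarrow> label_equiv K c' c"
  unfolding label_equiv_def
proof (elim exE conjE)
  fix \<sigma> assume \<sigma>: "\<sigma> permutes {1..K}" "c = \<sigma> \<circ> c'"
  show "\<exists>\<sigma>. \<sigma> permutes {1..K} \<and> c' = \<sigma> \<circ> c"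
  proof (intro exI conjI)
    show "inv \<sigma> permutes {1..K}" using \<sigma>(1) by (rule permutes_inv)
    have "inv \<sigma> \<circ> c = (inv \<sigma> \<circ> \<sigma>) \<circ> c'" by (simp add: \<sigma>(2) o_assoc)
    then show "c' = inv \<sigma> \<circ> c" by (simp add: permutes_inv_o(2)[OF \<sigma>(1)])
  qed
qed

lemma label_equiv_trans:
  "label_equiv K c c' \<Longrightarrow> label_equiv K c' c'' \<Longrightarrow> label_equiv K c c''"
  unfolding label_equiv_def by (metis permutes_compose o_assoc)

lemma tendsto_apply:
  fixes f :: "'a \<Rightarrow> 'i \<Rightarrow> 'b::topological_space"
  assumes "(f \<longlongrightarrow> l) F"
  shows "((\<lambda>x. f x i) \<longlongrightarrow> l i) F"
  using continuous_on_tendsto_compose[OF continuous_on_product_coordinates assms] by simp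

lemma eventually_in_at_within: "\<forall>\<^sub>F x in at a within S. x \<in> S"
  unfolding eventually_at_filter by (rule always_eventually) simp

lemma tendsto_imp_uniform_limit:
  assumes "(g \<longlongrightarrow> l) F"
  shows "uniform_limit X (\<lambda>a b. g a) (\<lambda>b. l) F"
  using assms by (auto intro!: uniform_limitI dest: tendstoD)

lemma uniform_limit_Pair:
  assumes "uniform_limit X f l F" "uniform_limit X g m F"
  shows "uniform_limit X (\<lambda>a b. (f a b, g a b)) (\<lambda>b. (l b, m b)) F"
proof (rule uniform_limitI)
  fix e :: real assume "0 < e"
  then have "0 < e / 2" by simp
  from uniform_limitD[OF assms(1) this] uniform_limitD[OF assms(2) this]
  show "\<forall>\<^sub>F a in F. \<forall>b\<in>X. dist (f a b, g a b) (l b, m b) < e"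
  proof eventually_elim
    case (elim a)
    show ?case
    proof
      fix b assume "b \<in> X"
      have "dist (f a b, g a b) (l b, m b) \<le> dist (f a b) (l b) + dist (g a b) (m b)"
        unfolding dist_Pair_Pair by (rule sqrt_sum_squares_le_sum) auto
      with elim \<open>b \<in> X\<close> show "dist (f a b, g a b) (l b, m b) < e" by fastforce
    qed
  qed
qed

lemma uniform_limit_sum:
  fixes f :: "'i \<Rightarrow> 'a \<Rightarrow> 'b \<Rightarrow> 'c::real_normed_vector"
  assumes "finite I" "\<And>i. i \<in> I \<Longrightarrow> uniform_limit X (f i) (l i) F"
  shows "uniform_limit X (\<lambda>a b. \<Sum>i\<in>I. f i a b) (\<lambda>b. \<Sum>i\<in>I. l i b) F"
  using assms
  by (induction I rule: finite_induct) (auto intro!: uniform_limit_add uniform_limit_const)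

lemma cINF_abs_diff_le:
  fixes g h :: "'b \<Rightarrow> real"
  assumes "X \<noteq> {}" "bdd_below (g ` X)" "bdd_below (h ` X)"
    and "\<And>x. x \<in> X \<Longrightarrow> \<bar>g x - h x\<bar> \<le> c"
  shows "\<bar>(INF x\<in>X. g x) - (INF x\<in>X. h x)\<bar> \<le> c"
proof -
  have "(INF x\<in>X. g x) - c \<le> (INF x\<in>X. h x)"
  proof (rule cINF_greatest[OF \<open>X \<noteq> {}\<close>])
    fix x assume "x \<in> X"
    with cINF_lower[OF assms(2) this] assms(4) show "(INF x\<in>X. g x) - c \<le> h x"
      by (fastforce simp: abs_le_iff)
  qed
  moreover have "(INF x\<in>X. h x) - c \<le> (INF x\<in>X. g x)"
  proof (rule cINF_greatest[OF \<open>X \<noteq> {}\<close>])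
    fix x assume "x \<in> X"
    with cINF_lower[OF assms(3) this] assms(4) show "(INF x\<in>X. h x) - c \<le> g x"
      by (fastforce simp: abs_le_iff)
  qed
  ultimately show ?thesis by linarith
qed

lemma abs_INF_inequivalent_diff_le:
  fixes u v :: "'t \<Rightarrow> real"
  assumes sym: "\<And>x y. R x y \<Longrightarrow> R y x" and trans: "\<And>x y z. R x y \<Longrightarrow> R y z \<Longrightarrow> R x z"
    and "a \<in> T" "b \<in> T" and ne: "{t\<in>T. \<not> R t a} \<noteq> {}" "{t\<in>T. \<not> R t b} \<noteq> {}"
    and u: "\<And>t. t \<in> T \<Longrightarrow> 0 \<le> u t" and v: "\<And>t. t \<in> T \<Longrightarrow> 0 \<le> v t"
    and "v b = 0" "v a \<le> \<eta>" and close: "\<And>t. t \<in> T \<Longrightarrow> \<bar>u t - v t\<bar> \<le> \<eta>"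
  shows "\<bar>(INF t\<in>{t\<in>T. \<not> R t a}. u t) - (INF t\<in>{t\<in>T. \<not> R t b}. v t)\<bar> \<le> \<eta>"
proof -
  have bdd: "bdd_below (u ` {t\<in>T. \<not> R t a})" "bdd_below (v ` {t\<in>T. \<not> R t b})"
    by (rule bdd_belowI2[where m = 0], use u v in auto)+
  show ?thesis
  proof (cases "R a b")
    case True
    then have eq: "{t\<in>T. \<not> R t a} = {t\<in>T. \<not> R t b}"
      using sym trans by blast
    show ?thesis
      unfolding eq
    proof (rule cINF_abs_diff_le)
      show "bdd_below (u ` {t\<in>T. \<not> R t b})" using bdd(1) unfolding eq .
    qed (use ne(2) bdd(2) close in auto)
  next
    case False
    then have "b \<in> {t\<in>T. \<not> R t a}" "a \<in> {t\<in>T. \<not> R t b}"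
      using \<open>a \<in> T\<close> \<open>b \<in> T\<close> sym by blast+
    then have "(INF t\<in>{t\<in>T. \<not> R t a}. u t) \<le> u b" "(INF t\<in>{t\<in>T. \<not> R t b}. v t) \<le> v a"
      using bdd by (auto intro: cINF_lower)
    moreover have "0 \<le> (INF t\<in>{t\<in>T. \<not> R t a}. u t)" "0 \<le> (INF t\<in>{t\<in>T. \<not> R t b}. v t)"
      using ne u v by (auto intro!: cINF_greatest)
    ultimately show ?thesis
      using close[OF \<open>b \<in> T\<close>] \<open>v b = 0\<close> \<open>v a \<le> \<eta>\<close> by linarith
  qed
qed

lemma continuous_on_INF_inequivalent:
  fixes f :: "'s::topological_space \<Rightarrow> 't \<Rightarrow> real"
  assumes sym: "\<And>x y. R x y \<Longrightarrow> R y x" and trans: "\<And>x y z. R x y \<Longrightarrow> R y z \<Longrightarrow> R x z"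
    and g: "\<And>s. s \<in> S \<Longrightarrow> g s \<in> T"
    and ne: "\<And>s. s \<in> S \<Longrightarrow> {t\<in>T. \<not> R t (g s)} \<noteq> {}"
    and nonneg: "\<And>s t. s \<in> S \<Longrightarrow> t \<in> T \<Longrightarrow> 0 \<le> f s t"
    and diag: "\<And>s. s \<in> S \<Longrightarrow> f s (g s) = 0"
    and unif: "\<And>s. s \<in> S \<Longrightarrow> uniform_limit T f (f s) (at s within S)"
    and diag_lim: "\<And>s. s \<in> S \<Longrightarrow> ((\<lambda>s'. f s (g s')) \<longlongrightarrow> 0) (at s within S)"
  shows "continuous_on S (\<lambda>s. INF t\<in>{t\<in>T. \<not> R t (g s)}. f s t)"
  unfolding continuous_on_def
proof (intro ballI tendstoI)
  fix s0 and e :: real assume s0: "s0 \<in> S" and "0 < e"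
  then have e2: "0 < e / 2" by simp
  have "\<forall>\<^sub>F s in at s0 within S. s \<in> S"
    by (rule eventually_in_at_within)
  moreover have "\<forall>\<^sub>F s in at s0 within S. \<forall>t\<in>T. dist (f s t) (f s0 t) < e / 2"
    using unif[OF s0] e2 by (rule uniform_limitD)
  moreover have "\<forall>\<^sub>F s in at s0 within S. dist (f s0 (g s)) 0 < e / 2"
    using diag_lim[OF s0] e2 by (rule tendstoD)
  ultimately show "\<forall>\<^sub>F s in at s0 within S.
      dist (INF t\<in>{t\<in>T. \<not> R t (g s)}. f s t) (INF t\<in>{t\<in>T. \<not> R t (g s0)}. f s0 t) < e"
  proof eventually_elim
    case (elim s)
    then have s: "s \<in> S" and close: "\<And>t. t \<in> T \<Longrightarrow> \<bar>f s t - f s0 t\<bar> \<le> e / 2"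
      and small: "f s0 (g s) \<le> e / 2"
      by (auto simp: dist_real_def)
    have "\<bar>(INF t\<in>{t\<in>T. \<not> R t (g s)}. f s t) - (INF t\<in>{t\<in>T. \<not> R t (g s0)}. f s0 t)\<bar> \<le> e / 2"
      by (rule abs_INF_inequivalent_diff_le[OF sym trans g[OF s] g[OF s0] ne[OF s] ne[OF s0]])
         (use nonneg s s0 diag close small in auto)
    then show ?case
      using \<open>0 < e\<close> by (simp add: dist_real_def)
  qed
qed

lemma continuous_on_INF_inequivalent_ereal:
  fixes f :: "'s::topological_space \<Rightarrow> 't \<Rightarrow> real"
  assumes sym: "\<And>x y. R x y \<Longrightarrow> R y x" and trans: "\<And>x y z. R x y \<Longrightarrow> R y z \<Longrightarrow> R x z"
    and g: "\<And>s. s \<in> S \<Longrightarrow> g s \<in> T"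
    and nonneg: "\<And>s t. s \<in> S \<Longrightarrow> t \<in> T \<Longrightarrow> 0 \<le> f s t"
    and diag: "\<And>s. s \<in> S \<Longrightarrow> f s (g s) = 0"
    and unif: "\<And>s. s \<in> S \<Longrightarrow> uniform_limit T f (f s) (at s within S)"
    and diag_lim: "\<And>s. s \<in> S \<Longrightarrow> ((\<lambda>s'. f s (g s')) \<longlongrightarrow> 0) (at s within S)"
  shows "continuous_on S (\<lambda>s. INF t\<in>{t\<in>T. \<not> R t (g s)}. ereal (f s t))"
proof (cases "\<exists>s\<in>S. {t\<in>T. \<not> R t (g s)} \<noteq> {}")
  case True
  then obtain s1 t1 where s1: "s1 \<in> S" and t1: "t1 \<in> T" "\<not> R t1 (g s1)" by blast
  have ne: "{t\<in>T. \<not> R t (g s)} \<noteq> {}" if "s \<in> S" for s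
  proof (cases "R (g s) (g s1)")
    case True
    then show ?thesis using t1 trans by blast
  next
    case False
    then show ?thesis using g[OF s1] sym by blast
  qed
  have "continuous_on S (\<lambda>s. ereal (INF t\<in>{t\<in>T. \<not> R t (g s)}. f s t))"
    using continuous_on_INF_inequivalent[where R = R and S = S and T = T and f = f and g = g,
        OF sym trans g ne nonneg diag unif diag_lim]
    by (rule continuous_on_ereal)
  then show ?thesis
  proof (rule continuous_on_eq)
    fix s assume "s \<in> S"
    have "bdd_below (f s ` {t\<in>T. \<not> R t (g s)})"
      by (rule bdd_belowI2[where m = 0]) (use nonneg[OF \<open>s \<in> S\<close>] in auto)
    then show "ereal (INF t\<in>{t\<in>T. \<not> R t (g s)}. f s t) =
        (INF t\<in>{t\<in>T. \<not> R t (g s)}. ereal (f s t))"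
      using ne[OF \<open>s \<in> S\<close>] by (simp add: ereal_Inf' image_comp)
  qed
next
  case False
  show ?thesis
    by (rule continuous_on_eq[OF continuous_on_const[of S "\<top> :: ereal"]]) (use False in auto)
qed

definition weighted_divergence ::
  "('m::finite \<Rightarrow> 'a \<Rightarrow> 'a \<Rightarrow> real) \<Rightarrow> ('m \<Rightarrow> real) \<times> ('m \<Rightarrow> 'a) \<Rightarrow> ('m \<Rightarrow> 'a) \<Rightarrow> real" where
  "weighted_divergence D s lam = (\<Sum>m\<in>UNIV. fst s m * D m (snd s m) (lam m))"

lemma uniform_limit_weighted_divergence:
  fixes D :: "'m::finite \<Rightarrow> 'a::metric_space \<Rightarrow> 'a \<Rightarrow> real"
  assumes "compact \<Theta>" and unif: "\<And>m. uniformly_continuous_on (\<Theta> \<times> \<Theta>) (\<lambda>(a, b). D m a b)"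
    and S: "S \<subseteq> UNIV \<times> {\<theta>. \<forall>m. \<theta> m \<in> \<Theta>}" and "s0 \<in> S"
  shows "uniform_limit {lam. \<forall>m. lam m \<in> \<Theta>} (weighted_divergence D) (weighted_divergence D s0)
           (at s0 within S)"
proof -
  define T where "T = {lam::'m \<Rightarrow> 'a. \<forall>m. lam m \<in> \<Theta>}"
  define F where "F = at s0 within S"
  have in_S: "\<forall>\<^sub>F s in F. s \<in> S"
    unfolding F_def by (rule eventually_in_at_within)
  have summand: "uniform_limit T (\<lambda>s lam. fst s m * D m (snd s m) (lam m))
      (\<lambda>lam. fst s0 m * D m (snd s0 m) (lam m)) F" for m
  proof -
    have weight: "uniform_limit T (\<lambda>s lam. fst s m) (\<lambda>lam. fst s0 m) F"
      unfolding F_def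
      by (rule tendsto_imp_uniform_limit[OF tendsto_apply[OF tendsto_fst[OF tendsto_ident_at]]])
    have "uniform_limit T (\<lambda>s lam. (snd s m, lam m)) (\<lambda>lam. (snd s0 m, lam m)) F"
      unfolding F_def
      by (rule uniform_limit_Pair[OF tendsto_imp_uniform_limit uniform_limit_const])
         (rule tendsto_apply[OF tendsto_snd[OF tendsto_ident_at]])
    moreover have "\<forall>\<^sub>F s in F. (\<lambda>lam. (snd s m, lam m)) ` T \<subseteq> \<Theta> \<times> \<Theta>"
      using in_S by eventually_elim (use S in \<open>auto simp: T_def\<close>)
    moreover have pairs: "(\<lambda>lam. (snd s0 m, lam m)) ` T \<subseteq> \<Theta> \<times> \<Theta>"
      using S \<open>s0 \<in> S\<close> by (auto simp: T_def)
    ultimately have "uniform_limit T (\<lambda>s lam. (\<lambda>(a, b). D m a b) (snd s m, lam m))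
        ((\<lambda>(a, b). D m a b) \<circ> (\<lambda>lam. (snd s0 m, lam m))) F"
      by (rule uniform_limit_compose[OF _ unif[of m]])
    then have div:
        "uniform_limit T (\<lambda>s lam. D m (snd s m) (lam m)) (\<lambda>lam. D m (snd s0 m) (lam m)) F"
      by (simp add: comp_def)
    have "bounded ((\<lambda>lam. fst s0 m) ` T)"
      by (rule finite_imp_bounded) (simp add: image_constant_conv)
    moreover have "compact ((\<lambda>(a, b). D m a b) ` (\<Theta> \<times> \<Theta>))"
      using unif[of m] \<open>compact \<Theta>\<close>
      by (intro compact_continuous_image compact_Times uniformly_continuous_imp_continuous)
    moreover have "(\<lambda>lam. D m (snd s0 m) (lam m)) ` T \<subseteq> (\<lambda>(a, b). D m a b) ` (\<Theta> \<times> \<Theta>)"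
      using image_mono[OF pairs, of "\<lambda>(a, b). D m a b"] by (simp add: image_image)
    ultimately show ?thesis
      using uniform_lim_mult[OF weight div] by (meson bounded_subset compact_imp_bounded)
  qed
  show ?thesis
    unfolding weighted_divergence_def T_def[symmetric] F_def[symmetric]
    by (rule uniform_limit_sum) (simp_all add: summand)
qed

lemma tendsto_weighted_divergence_snd:
  fixes D :: "'m::finite \<Rightarrow> 'a::metric_space \<Rightarrow> 'a \<Rightarrow> real"
  assumes cont: "\<And>m. continuous_on (\<Theta> \<times> \<Theta>) (\<lambda>(a, b). D m a b)"
    and S: "S \<subseteq> UNIV \<times> {\<theta>. \<forall>m. \<theta> m \<in> \<Theta>}" and "s0 \<in> S"
  shows "((\<lambda>s. weighted_divergence D s0 (snd s)) \<longlongrightarrow> weighted_divergence D s0 (snd s0))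
           (at s0 within S)"
proof -
  have "((\<lambda>s. D m (snd s0 m) (snd s m)) \<longlongrightarrow> D m (snd s0 m) (snd s0 m)) (at s0 within S)" for m
  proof -
    have "((\<lambda>s. (snd s0 m, snd s m)) \<longlongrightarrow> (snd s0 m, snd s0 m)) (at s0 within S)"
      by (rule tendsto_Pair[OF tendsto_const tendsto_apply[OF tendsto_snd[OF tendsto_ident_at]]])
    moreover have "\<forall>\<^sub>F s in at s0 within S. (snd s0 m, snd s m) \<in> \<Theta> \<times> \<Theta>"
      using eventually_in_at_within by (rule eventually_mono) (use S \<open>s0 \<in> S\<close> in auto)
    ultimately show ?thesis
      using continuous_on_tendsto_compose[OF cont[of m]] S \<open>s0 \<in> S\<close> by fastforce
  qed
  then show ?thesis
    unfolding weighted_divergence_def by (intro tendsto_intros)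
qed

lemma continuous_on_INF_weighted_divergence:
  fixes D :: "'m::finite \<Rightarrow> 'a::metric_space \<Rightarrow> 'a \<Rightarrow> real"
  assumes "compact \<Theta>" and unif: "\<And>m. uniformly_continuous_on (\<Theta> \<times> \<Theta>) (\<lambda>(a, b). D m a b)"
    and nonneg: "\<And>m a b. a \<in> \<Theta> \<Longrightarrow> b \<in> \<Theta> \<Longrightarrow> 0 \<le> D m a b"
    and self: "\<And>m a. a \<in> \<Theta> \<Longrightarrow> D m a a = 0"
    and sym: "\<And>x y. R x y \<Longrightarrow> R y x" and trans: "\<And>x y z. R x y \<Longrightarrow> R y z \<Longrightarrow> R x z"
  defines "T \<equiv> {\<theta>. \<forall>m. \<theta> m \<in> \<Theta>}"
  shows "continuous_on (prob_simplex \<times> T)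
           (\<lambda>(w, \<theta>). INF lam\<in>{lam\<in>T. \<not> R lam \<theta>}. ereal (\<Sum>m\<in>UNIV. w m * D m (\<theta> m) (lam m)))"
proof -
  have S: "prob_simplex \<times> T \<subseteq> UNIV \<times> {\<theta>. \<forall>m. \<theta> m \<in> \<Theta>}"
    by (auto simp: T_def)
  have "continuous_on (prob_simplex \<times> T)
      (\<lambda>s. INF lam\<in>{lam\<in>T. \<not> R lam (snd s)}. ereal (weighted_divergence D s lam))"
  proof (rule continuous_on_INF_inequivalent_ereal[OF sym trans])
    fix s :: "('m \<Rightarrow> real) \<times> ('m \<Rightarrow> 'a)"
    assume s: "s \<in> prob_simplex \<times> T"
    then show "snd s \<in> T" by auto
    show "0 \<le> weighted_divergence D s lam" if "lam \<in> T" for lam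
      using s that unfolding weighted_divergence_def
      by (intro sum_nonneg mult_nonneg_nonneg nonneg) (auto simp: prob_simplex_def T_def)
    show diag: "weighted_divergence D s (snd s) = 0"
      using s by (simp add: weighted_divergence_def self T_def mem_Times_iff)
    show "uniform_limit T (weighted_divergence D) (weighted_divergence D s)
        (at s within prob_simplex \<times> T)"
      using uniform_limit_weighted_divergence[OF \<open>compact \<Theta>\<close> unif S s] by (simp only: T_def)
    show "((\<lambda>s'. weighted_divergence D s (snd s')) \<longlongrightarrow> 0) (at s within prob_simplex \<times> T)"
      using tendsto_weighted_divergence_snd[where D = D,
          OF uniformly_continuous_imp_continuous[OF unif] S s]
      unfolding diag .
  qed
  then show ?thesis
    by (rule continuous_on_eq) (auto simp: weighted_divergence_def)
qed

theorem lemma1: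
  fixes P :: "'m::finite \<Rightarrow> 'a::euclidean_space \<Rightarrow> 'x measure"
    and \<Theta> :: "'a set" and K :: nat
    and tb :: "('m set \<times> 'm set) set \<Rightarrow> 'm set \<times> 'm set"
  assumes K: "1 < K" "K < CARD('m)"
    and cpt: "compact \<Theta>"
    and tb: "\<And>S. S \<noteq> {} \<Longrightarrow> tb S \<in> S"
    and prob: "\<And>m r. r \<in> \<Theta> \<Longrightarrow> prob_space (P m r)"
    and same_space: "\<And>m r1 r2. r1 \<in> \<Theta> \<Longrightarrow> r2 \<in> \<Theta> \<Longrightarrow> sets (P m r1) = sets (P m r2)"
    and ac: "\<And>m r1 r2. r1 \<in> \<Theta> \<Longrightarrow> r2 \<in> \<Theta> \<Longrightarrow> absolutely_continuous (P m r2) (P m r1)"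
    and finite_KL: "\<And>m r1 r2. r1 \<in> \<Theta> \<Longrightarrow> r2 \<in> \<Theta> \<Longrightarrow>
                      integrable (P m r1) (entropy_density (exp 1) (P m r2) (P m r1))"
    and unif: "\<And>m. uniformly_continuous_on (\<Theta> \<times> \<Theta>) (\<lambda>(r1, r2). KLdiv P m r1 r2)"
  shows "continuous_on (prob_simplex \<times> {\<theta>. \<forall>m. \<theta> m \<in> \<Theta>}) (\<lambda>(w, \<theta>). psi P tb K \<Theta> w \<theta>)"
proof -
  define R where "R lam \<theta> \<longleftrightarrow> label_equiv K (cluster_index tb K lam) (cluster_index tb K \<theta>)"
    for lam \<theta> :: "'m \<Rightarrow> 'a"
  have "continuous_on (prob_simplex \<times> {\<theta>. \<forall>m. \<theta> m \<in> \<Theta>}) (\<lambda>(w, \<theta>).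
      INF lam\<in>{lam\<in>{\<theta>. \<forall>m. \<theta> m \<in> \<Theta>}. \<not> R lam \<theta>}. ereal (\<Sum>m\<in>UNIV. w m * KLdiv P m (\<theta> m) (lam m)))"
  proof (rule continuous_on_INF_weighted_divergence[OF cpt unif])
    show "0 \<le> KLdiv P m a b" if "a \<in> \<Theta>" "b \<in> \<Theta>" for m a b
      using that by (intro KLdiv_nonneg prob same_space ac finite_KL)
    show "KLdiv P m a a = 0" if "a \<in> \<Theta>" for m a
      using that by (intro KLdiv_self prob)
    show "R y x" if "R x y" for x y
      using that label_equiv_sym unfolding R_def by blast
    show "R x z" if "R x y" "R y z" for x y z
      using that label_equiv_trans unfolding R_def by blast
  qed
  then show ?thesis
    by (simp add: psi_def Alt_def R_def)
qed

end
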